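(* Let $\{m\}_n = \underbrace{1 \cdots 1}_{k_0}\underbrace{0 \cdots 0}_{k_1}\cdots\underbrace{0 \cdots 0}_{k_{l-2}}\underbrace{1 \cdots 1}_{k_{l-1}}$ be a finite design (with $l$ odd, $k_0 \ge 0$, $k_i \ge 1$ for $1 \le i \le l-2$, $k_{l-1} \ge 0$, $n=\sum_{i=0}^{l-1} k_i$, $0 \le m \le 2^n-1$) and suppose $U(\{m\}_n) = \begin{pmatrix} a & b \\ c & d \end{pmatrix}$. Then: (1) $U(\{m^*\}_n) = U\big(\underbrace{1 \cdots 1}_{k_{l-1}}\underbrace{0 \cdots 0}_{k_{l-2}}\cdots\underbrace{0 \cdots 0}_{k_1}\underbrace{1 \cdots 1}_{k_0}\big) = \begin{pmatrix} d & b \\ c & a \end{pmatrix}$. (2) $U(\{2^n-(m^*+1)\}_n) = U\big(\underbrace{0 \cdots 0}_{k_{l-1}}\underbrace{1 \cdots 1}_{k_{l-2}}\cdots\underbrace{1 \cdots 1}_{k_1}\underbrace{0 \cdots 0}_{k_0}\big) = \begin{pmatrix} a & c \\ b & d \end{pmatrix}$. (3) $U(\{2^n-(m+1)\}_n) = U\big(\underbrace{0 \cdots 0}_{k_0}\underbrace{1 \cdots 1}_{k_1}\cdots\underbrace{1 \cdots 1}_{k_{l-2}}\underbrace{0 \cdots 0}_{k_{l-1}}\big) = \begin{pmatrix} d & c \\ b & a \end{pmatrix}$.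
   Context: Stern's diatomic integers $[2^n:m]$ ($0 \le m \le 2^n$) are defined by $[2^0:0]=0$, $[2^0:1]=1$, $[2^{n+1}:2m]=[2^n:m]$, $[2^{n+1}:2m+1]=[2^n:m]+[2^n:m+1]$. For $0 \le m \le 2^n-1$, the design $\{m\}_n$ is the length-$n$ binary word $d_1\cdots d_n$ with $\sum_{i=1}^n 2^{n-i}d_i = m$, and one writes $[\{m\}_n]=[2^n:m]$. The Stern's diatomic matrix is $U(\{m\}_n)=U(2^n:m)=\begin{pmatrix} [2^n:m+1] & [2^n:m] \\ [2^n:2^n-(m+1)] & [2^n:2^n-m] \end{pmatrix}$. For a finite design $D=\underbrace{1 \cdots 1}_{k_0}\underbrace{0 \cdots 0}_{k_1}\cdots\underbrace{0 \cdots 0}_{k_{l-2}}\underbrace{1 \cdots 1}_{k_{l-1}}$ ($l$ odd, $k_0 \ge 0$, $k_i\ge1$ for $1\le i\le l-2$, $k_{l-1}\ge 0$), its inverse design is $D^*=\underbrace{1 \cdots 1}_{k_{l-1}}\underbrace{0 \cdots 0}_{k_{l-2}}\cdots\underbrace{0 \cdots 0}_{k_1}\underbrace{1 \cdots 1}_{k_0}$; if $D=\{m\}_n$ one writes $D^*=\{m^*\}_n$. Also $\{2^n - m'\}_n$ denotes the design of $2^n-m'$ with length $n$. *)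

theory Defs
  imports "HOL-Analysis.Analysis"
begin

text \<open>\<open>stern n m\<close> is \<open>[2^n:m]\<close>; only arguments \<open>m \<le> 2^n\<close> are meaningful, and
  this range is respected by the recursion.\<close>

fun stern :: "nat \<Rightarrow> nat \<Rightarrow> int" where
  "stern 0 m = (if m = 1 then 1 else 0)"
| "stern (Suc n) m =
     (if even m then stern n (m div 2) else stern n (m div 2) + stern n (m div 2 + 1))"

lemma stern_rules:
  "stern 0 0 = 0"
  "stern 0 1 = 1"
  "stern (n + 1) (2 * m) = stern n m"
  "stern (n + 1) (2 * m + 1) = stern n m + stern n (m + 1)"
  by auto

definition design_value :: "nat list \<Rightarrow> nat" where
  "design_value D = (\<Sum>i = 1..length D. 2 ^ (length D - i) * D ! (i - 1))"

definition design :: "nat \<Rightarrow> nat \<Rightarrow> nat list" where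
  "design n m = (THE D. length D = n \<and> set D \<subseteq> {0, 1} \<and> design_value D = m)"

definition stern_matrix :: "nat \<Rightarrow> nat \<Rightarrow> int ^ 2 ^ 2" where
  "stern_matrix n m =
     vector [vector [stern n (m + 1),       stern n m],
             vector [stern n (2^n - (m + 1)), stern n (2^n - m)]]"

definition U :: "nat list \<Rightarrow> int ^ 2 ^ 2" where
  "U D = stern_matrix (length D) (design_value D)"

text \<open>The word consisting of \<open>l\<close> blocks of lengths \<open>k 0, \<dots>, k (l - 1)\<close>, with
  digit \<open>b\<close> in the blocks of even index and the other digit in those of odd index.\<close>

definition runs :: "nat \<Rightarrow> nat \<Rightarrow> (nat \<Rightarrow> nat) \<Rightarrow> nat list" where
  "runs b l k = concat (map (\<lambda>i. replicate (k i) (if even i then b else 1 - b)) [0..<l])"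

definition inverse_design :: "nat list \<Rightarrow> nat list" where
  "inverse_design D = (THE E. \<exists>l k. odd l \<and> (\<forall>i. 1 \<le> i \<and> i \<le> l - 2 \<longrightarrow> k i \<ge> 1) \<and>
     D = runs 1 l k \<and> E = runs 1 l (\<lambda>i. k (l - 1 - i)))"

text \<open>\<open>star n m\<close> is \<open>m\<^sup>*\<close>.\<close>

definition star :: "nat \<Rightarrow> nat \<Rightarrow> nat" where
  "star n m = (THE m'. m' < 2 ^ n \<and> design n m' = inverse_design (design n m))"

text \<open>Every \<open>m < 2^n\<close> has exactly one design of length \<open>n\<close>, and the inverse
  design does not depend on the chosen block decomposition.\<close>

lemma design_value_Nil [simp]: "design_value [] = 0"
  by (simp add: design_value_def)

lemma design_value_Cons [simp]: "design_value (x # D) = 2 ^ length D * x + design_value D"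
proof -
  have "(\<Sum>i = Suc 1..Suc (length D). 2 ^ (Suc (length D) - i) * (x # D) ! (i - 1))
      = (\<Sum>i = 1..length D. 2 ^ (length D - i) * D ! (i - 1))"
    by (subst sum.shift_bounds_cl_Suc_ivl) (auto intro!: sum.cong simp: nth_Cons')
  moreover have "design_value (x # D) = 2 ^ length D * x
      + (\<Sum>i = Suc 1..Suc (length D). 2 ^ (Suc (length D) - i) * (x # D) ! (i - 1))"
    unfolding design_value_def by (subst sum.atLeast_Suc_atMost) auto
  ultimately show ?thesis
    by (simp only: design_value_def)
qed

lemma design_value_less: "set D \<subseteq> {0, 1} \<Longrightarrow> design_value D < 2 ^ length D"
  by (induction D) auto

lemma design_ex1:
  "m < 2 ^ n \<Longrightarrow> \<exists>!D. length D = n \<and> set D \<subseteq> {0, 1} \<and> design_value D = m"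
proof (induction n arbitrary: m)
  case 0
  then show ?case by auto
next
  case (Suc n)
  define x where "x = (if m < 2 ^ n then 0 else 1 :: nat)"
  define r where "r = m - 2 ^ n * x"
  have r: "r < 2 ^ n" and m: "m = 2 ^ n * x + r"
    using Suc.prems by (auto simp: x_def r_def)
  obtain D where D: "length D = n" "set D \<subseteq> {0, 1}" "design_value D = r"
    using Suc.IH[OF r] by blast
  show ?case
  proof (rule ex1I[of _ "x # D"])
    show "length (x # D) = Suc n \<and> set (x # D) \<subseteq> {0, 1} \<and> design_value (x # D) = m"
      using D m by (auto simp: x_def)
  next
    fix E assume E: "length E = Suc n \<and> set E \<subseteq> {0, 1} \<and> design_value E = m"
    then obtain y F where F: "E = y # F" by (cases E) auto
    have y: "y \<in> {0, 1}" "set F \<subseteq> {0, 1}" "length F = n" using E F by auto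
    have lt: "design_value F < 2 ^ n" using design_value_less[of F] y by simp
    have eq: "2 ^ n * y + design_value F = 2 ^ n * x + r" using E F m y by simp
    have "y = x" using eq lt r y(1) by (auto simp: x_def split: if_splits)
    moreover from this have "design_value F = r" using eq by simp
    then have "F = D"
      by (rule_tac Uniq_D[OF ex1_iff_ex_Uniq[THEN iffD1, THEN conjunct2, OF Suc.IH[OF r]]])
        (use D y in auto)
    ultimately show "E = x # D" using F by simp
  qed
qed

lemma runs_reverse:
  assumes "odd l"
  shows "runs b l (\<lambda>i. k (l - 1 - i)) = rev (runs b l k)"
proof -
  have "rev [0..<l] = map (\<lambda>i. l - 1 - i) [0..<l]"
    by (rule nth_equalityI) (auto simp: rev_nth)
  then show ?thesis
    using assms
    by (auto simp: runs_def rev_concat rev_map intro!: arg_cong[of _ _ concat])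
qed

lemma inverse_design_runs:
  assumes "odd l" "\<forall>i. 1 \<le> i \<and> i \<le> l - 2 \<longrightarrow> k i \<ge> 1"
  shows "inverse_design (runs 1 l k) = runs 1 l (\<lambda>i. k (l - 1 - i))"
  unfolding inverse_design_def
proof (rule the_equality)
  show "\<exists>l' k'. odd l' \<and> (\<forall>i. 1 \<le> i \<and> i \<le> l' - 2 \<longrightarrow> k' i \<ge> 1) \<and>
     runs 1 l k = runs 1 l' k' \<and>
     runs 1 l (\<lambda>i. k (l - 1 - i)) = runs 1 l' (\<lambda>i. k' (l' - 1 - i))"
    using assms by blast
next
  fix E
  assume "\<exists>l' k'. odd l' \<and> (\<forall>i. 1 \<le> i \<and> i \<le> l' - 2 \<longrightarrow> k' i \<ge> 1) \<and>
     runs 1 l k = runs 1 l' k' \<and> E = runs 1 l' (\<lambda>i. k' (l' - 1 - i))"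
  then show "E = runs 1 l (\<lambda>i. k (l - 1 - i))"
    using assms(1) by (metis runs_reverse)
qed

end

theory Submission
  imports Defs
begin

text \<open>Appending a digit \<open>x\<close> to a word multiplies \<open>U\<close> on the right by an elementary matrix
  \<open>E x\<close>, so that \<open>U (d\<^sub>1 \<dots> d\<^sub>n) = E d\<^sub>1 ** \<dots> ** E d\<^sub>n\<close>. Reflection in the antidiagonal is an
  anti-automorphism of the matrix ring fixing \<open>E 0\<close> and \<open>E 1\<close>, hence realises the reversal of
  the word. Complementing the digits replaces \<open>m\<close> by \<open>2^n - (m + 1)\<close>, which swaps the
  entries of \<open>U\<close> along both diagonals; composing the two gives the transpose.\<close>

definition digit_matrix :: "nat \<Rightarrow> int ^ 2 ^ 2" where
  "digit_matrix x =
     (if x = 0 then vector [vector [1, 0], vector [1, 1]]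
      else vector [vector [1, 1], vector [0, 1]])"

definition antitranspose :: "int ^ 2 ^ 2 \<Rightarrow> int ^ 2 ^ 2" where
  "antitranspose A = vector [vector [A $ 2 $ 2, A $ 1 $ 2], vector [A $ 2 $ 1, A $ 1 $ 1]]"

text \<open>The antitranspose is the transpose conjugated by the swap matrix, an involution, so it
  reverses products just as the transpose does.\<close>

lemma antitranspose_mult: "antitranspose (A ** B) = antitranspose B ** antitranspose A"
  by (simp add: antitranspose_def matrix_matrix_mult_def vec_eq_iff forall_2 sum_2 algebra_simps)

lemma antitranspose_digit_matrix: "antitranspose (digit_matrix x) = digit_matrix x"
  by (simp add: antitranspose_def digit_matrix_def vec_eq_iff forall_2)

lemma design_value_snoc: "design_value (D @ [x]) = 2 * design_value D + x"
  by (induction D) (auto simp: algebra_simps)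

text \<open>The Stern recursion acts linearly on a pair of neighbouring values. The second row is
  such a pair too, at indices counted from the right end \<open>2 ^ n\<close>.\<close>

lemma stern_matrix_Suc:
  assumes "m < 2 ^ n" "x \<in> {0, 1}"
  shows "stern_matrix (Suc n) (2 * m + x) = stern_matrix n m ** digit_matrix x"
proof -
  \<comment> \<open>Naming the reflected index turns the truncated subtractions into
    \<open>2 * r\<close> and the like, whose parity the recursion can read.\<close>
  define r where "r = 2 ^ n - Suc m"
  have r: "2 ^ n = m + r + 1"
    using assms by (simp add: r_def)
  have "2 * 2 ^ n - Suc (2 * m) = 2 * r + 1" "2 * 2 ^ n - 2 * m = 2 * (r + 1)"
    "2 * 2 ^ n - Suc (Suc (2 * m)) = 2 * r" "2 ^ n - Suc m = r" "2 ^ n - m = r + 1"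
    using r by auto
  then show ?thesis
    using assms(2)
    by (auto simp: stern_matrix_def digit_matrix_def matrix_matrix_mult_def vec_eq_iff forall_2
        sum_2)
qed

lemma U_Nil: "U [] = mat 1"
  by (simp add: U_def stern_matrix_def mat_def vec_eq_iff forall_2)

lemma U_snoc:
  assumes "set D \<subseteq> {0, 1}" "x \<in> {0, 1}"
  shows "U (D @ [x]) = U D ** digit_matrix x"
  using stern_matrix_Suc[OF design_value_less[OF assms(1)] assms(2)]
  by (simp add: U_def design_value_snoc)

lemma U_Cons:
  assumes "set D \<subseteq> {0, 1}" "x \<in> {0, 1}"
  shows "U (x # D) = digit_matrix x ** U D"
  using assms
\<comment> \<open>The recursion only appends digits, so the induction peels the right end;
  associativity then leaves the factor of \<open>x\<close> in front.\<close>
proof (induction D rule: rev_induct)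
  case Nil
  then show ?case using U_snoc[of "[]" x] by (simp add: U_Nil)
next
  case (snoc y D)
  then show ?case
    using U_snoc[of "x # D" y] U_snoc[of D y] by (simp add: matrix_mul_assoc)
qed

lemma U_rev:
  assumes "set D \<subseteq> {0, 1}"
  shows "U (rev D) = antitranspose (U D)"
  using assms
proof (induction D)
  case Nil
  then show ?case by (simp add: U_Nil antitranspose_def mat_def vec_eq_iff forall_2)
next
  case (Cons x D)
  then show ?case
    by (simp add: U_snoc U_Cons antitranspose_mult antitranspose_digit_matrix)
qed

definition complement :: "nat list \<Rightarrow> nat list" where
  "complement = map (\<lambda>x. 1 - x)"

lemma length_complement [simp]: "length (complement D) = length D"
  by (simp add: complement_def)

lemma set_complement: "set (complement D) \<subseteq> {0, 1}"
  by (auto simp: complement_def)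

lemma design_value_complement:
  assumes "set D \<subseteq> {0, 1}"
  shows "design_value (complement D) = 2 ^ length D - (design_value D + 1)"
proof -
  \<comment> \<open>In each place the two digits add up to 1. The additive form keeps truncated
    subtraction out of the induction.\<close>
  have "design_value (complement D) + design_value D + 1 = 2 ^ length D"
    using assms by (induction D) (auto simp: complement_def)
  then show ?thesis by simp
qed

text \<open>Replacing \<open>m\<close> by \<open>2 ^ n - (m + 1)\<close> interchanges the indices of
  diagonally opposite entries; \<open>m < 2 ^ n\<close> makes the double subtractions exact.\<close>

lemma U_complement:
  assumes "set D \<subseteq> {0, 1}" "U D = vector [vector [a, b], vector [c, d]]"
  shows "U (complement D) = vector [vector [d, c], vector [b, a]]"
  using assms design_value_less[OF assms(1)]
  by (simp add: U_def design_value_complement stern_matrix_def vec_eq_iff forall_2 Suc_diff_Suc)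

lemma complement_runs: "complement (runs 1 l k) = runs 0 l k"
  by (auto simp: complement_def runs_def map_concat intro!: arg_cong[of _ _ concat])

lemma design_eqI:
  assumes "length D = n" "set D \<subseteq> {0, 1}" "design_value D = m"
  shows "design n m = D"
  unfolding design_def
  using assms design_value_less[of D] by (intro the1_equality design_ex1) auto

lemma design_props:
  assumes "m < 2 ^ n"
  shows "length (design n m) = n" "set (design n m) \<subseteq> {0, 1}" "design_value (design n m) = m"
  using theI'[OF design_ex1[OF assms]] by (auto simp: design_def)

lemma star_eq:
  assumes "m < 2 ^ n" "inverse_design (design n m) = rev (design n m)"
  shows "star n m = design_value (rev (design n m))"
  unfolding star_def
proof (rule the_equality)
  show "design_value (rev (design n m)) < 2 ^ n \<and>
      design n (design_value (rev (design n m))) = inverse_design (design n m)"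
    using design_props[OF assms(1)] design_value_less[of "rev (design n m)"] assms(2)
    by (auto intro!: design_eqI)
next
  fix m' assume "m' < 2 ^ n \<and> design n m' = inverse_design (design n m)"
  \<comment> \<open>A number is recovered from its design by \<open>design_value\<close>, which
    gives uniqueness.\<close>
  then show "m' = design_value (rev (design n m))"
    using design_props(3)[of m' n] assms(2) by simp
qed

theorem theorem5p6:
  fixes n m l :: nat and k :: "nat \<Rightarrow> nat" and a b c d :: int
  assumes "odd l"
    and "\<forall>i. 1 \<le> i \<and> i \<le> l - 2 \<longrightarrow> k i \<ge> 1"
    and "n = (\<Sum>i = 0..l - 1. k i)"
    and "m \<le> 2 ^ n - 1"
    and "design n m = runs 1 l k"
    and "U (design n m) = vector [vector [a, b], vector [c, d]]"
  shows "(U (design n (star n m)) = U (runs 1 l (\<lambda>i. k (l - 1 - i))) \<and>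
          U (runs 1 l (\<lambda>i. k (l - 1 - i))) = vector [vector [d, b], vector [c, a]]) \<and>
         (U (design n (2 ^ n - (star n m + 1))) = U (runs 0 l (\<lambda>i. k (l - 1 - i))) \<and>
          U (runs 0 l (\<lambda>i. k (l - 1 - i))) = vector [vector [a, c], vector [b, d]]) \<and>
         (U (design n (2 ^ n - (m + 1))) = U (runs 0 l k) \<and>
          U (runs 0 l k) = vector [vector [d, c], vector [b, a]])"
proof -
  define D where "D = design n m"
  have m: "m < 2 ^ n"
    using assms(4) by (metis Suc_pred' le_imp_less_Suc zero_less_numeral zero_less_power
        diff_Suc_1 One_nat_def)
  have D: "length D = n" "set D \<subseteq> {0, 1}" "design_value D = m"
    using design_props[OF m] by (auto simp: D_def)
  have runs: "runs 1 l k = D"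
    using assms(5) by (simp add: D_def)
  have runs_rev: "runs 1 l (\<lambda>i. k (l - 1 - i)) = rev D"
    using runs_reverse[OF assms(1)] runs by simp
  have runs0: "runs 0 l k = complement D"
    "runs 0 l (\<lambda>i. k (l - 1 - i)) = complement (rev D)"
    using complement_runs runs runs_rev by metis+
  \<comment> \<open>The block decomposition identifies the inverse design with the reversed
    word.\<close>
  have star: "star n m = design_value (rev D)"
    using star_eq[OF m] inverse_design_runs[OF assms(1,2)] runs runs_rev by (simp add: D_def)
  have U_D: "U D = vector [vector [a, b], vector [c, d]]"
    using assms(6) by (simp add: D_def)
  have U_rev_D: "U (rev D) = vector [vector [d, b], vector [c, a]]"
    using U_rev[OF D(2)] U_D by (simp add: antitranspose_def)
  have "design n (star n m) = rev D"
    using D by (intro design_eqI) (auto simp: star)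
  moreover have "design n (2 ^ n - (star n m + 1)) = complement (rev D)"
    using D design_value_complement[of "rev D"] set_complement
    by (intro design_eqI) (auto simp: star)
  moreover have "design n (2 ^ n - (m + 1)) = complement D"
    using D design_value_complement[of D] set_complement by (intro design_eqI) auto
  moreover have "U (complement (rev D)) = vector [vector [a, c], vector [b, d]]"
    using U_complement[OF _ U_rev_D] D(2) by simp
  ultimately show ?thesis
    using U_rev_D U_complement[OF D(2) U_D] by (simp only: runs_rev runs0 simp_thms)
qed

end
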